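(* Let $n\ge1$ be an integer and let $\xi$ be a real number which is not algebraic of degree $\le n$. Then $$\hat{w}_n^*(\xi)\ge \frac{w_n(\xi)}{w_n(\xi)-n+1}\qquad\text{and}\qquad w_n^*(\xi)\ge \frac{\hat{w}_n(\xi)}{\hat{w}_n(\xi)-n+1}.$$
   Context: For an integer polynomial $P$, $H(P)$ is the maximum of the absolute values of its coefficients; for a real algebraic number $\alpha$, $H(\alpha)$ is the height of its minimal polynomial over $\mathbb{Z}$. For a real $\xi$ and integer $n\ge1$: $w_n(\xi)$ is the supremum of the real $w$ such that $0<|P(\xi)|\le H(P)^{-w}$ holds for infinitely many integer polynomials $P$ of degree $\le n$. $w_n^*(\xi)$ is the supremum of the real $w^*$ such that $0<|\xi-\alpha|\le H(\alpha)^{-w^*-1}$ holds for infinitely many real algebraic $\alpha$ of degree $\le n$. $\hat{w}_n(\xi)$ is the supremum of the real $w$ such that for every sufficiently large real $X$ there are integers $x_0,\dots,x_n$ with $0<|x_n\xi^n+\dots+x_1\xi+x_0|\le X^{-w}$ and $\max_m|x_m|\le X$. $\hat{w}_n^*(\xi)$ is the supremum of the real $w$ such that for every sufficiently large real $X$ there is a real algebraic $\alpha$ of degree $\le n$ with $0<|\xi-\alpha|\le H(\alpha)^{-1}X^{-w}$ and $H(\alpha)\le X$. *)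

theory Defs
  imports
    "HOL-Analysis.Analysis"
    "HOL-Computational_Algebra.Polynomial"
begin

abbreviation int_poly_eval :: "int poly \<Rightarrow> real \<Rightarrow> real" where
  "int_poly_eval P x \<equiv> poly (map_poly of_int P) x"

definition int_poly_height :: "int poly \<Rightarrow> int" where
  "int_poly_height P = (MAX i\<in>{..degree P}. \<bar>coeff P i\<bar>)"

definition is_min_int_poly :: "real \<Rightarrow> int poly \<Rightarrow> bool" where
  "is_min_int_poly \<alpha> P \<longleftrightarrow>
     int_poly_eval P \<alpha> = 0 \<and> Polynomial.content P = 1 \<and> lead_coeff P > 0 \<and>
     (\<forall>Q. Q \<noteq> 0 \<and> int_poly_eval Q \<alpha> = 0 \<longrightarrow> degree P \<le> degree Q)"

text \<open>The value is meaningful only for algebraic \<open>\<alpha>\<close>, where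
  \<open>is_min_int_poly_ex1\<close> below gives existence and uniqueness.\<close>

definition min_int_poly :: "real \<Rightarrow> int poly" where
  "min_int_poly \<alpha> = (THE P. is_min_int_poly \<alpha> P)"

definition alg_degree :: "real \<Rightarrow> nat" where
  "alg_degree \<alpha> = degree (min_int_poly \<alpha>)"

definition alg_height :: "real \<Rightarrow> int" where
  "alg_height \<alpha> = int_poly_height (min_int_poly \<alpha>)"

lemma int_poly_eval_smult: "int_poly_eval (smult c P) x = of_int c * int_poly_eval P x"
proof -
  have "map_poly real_of_int (smult c P) = smult (of_int c) (map_poly of_int P)"
    by (rule poly_eqI) (simp add: coeff_map_poly)
  then show ?thesis by simp
qed

lemma int_poly_eval_diff: "int_poly_eval (P - Q) x = int_poly_eval P x - int_poly_eval Q x"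
proof -
  have "map_poly real_of_int (P - Q) = map_poly of_int P - map_poly of_int Q"
    by (rule poly_eqI) (simp add: coeff_map_poly)
  then show ?thesis by simp
qed

lemma is_min_int_poly_unique:
  assumes P: "is_min_int_poly \<alpha> P" and Q: "is_min_int_poly \<alpha> Q"
  shows "P = Q"
proof -
  let ?a = "lead_coeff P" and ?b = "lead_coeff Q"
  let ?R = "smult ?b P - smult ?a Q"
  have pos: "?a > 0" "?b > 0" and nz: "P \<noteq> 0" "Q \<noteq> 0"
    using P Q by (auto simp: is_min_int_poly_def)
  have deg: "degree P = degree Q"
    using P Q nz unfolding is_min_int_poly_def by (meson le_antisym)
  have ev: "int_poly_eval ?R \<alpha> = 0"
    using P Q by (simp add: is_min_int_poly_def int_poly_eval_diff int_poly_eval_smult)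
  have R0: "?R = 0"
  proof (rule ccontr)
    assume R: "?R \<noteq> 0"
    then have "degree P \<le> degree ?R"
      using P ev by (simp add: is_min_int_poly_def)
    moreover have "degree ?R \<le> degree P"
      by (intro degree_diff_le) (auto simp: deg)
    ultimately have "degree ?R = degree P" by simp
    then have "lead_coeff ?R = 0" by (simp add: deg)
    then show False using R by (metis leading_coeff_0_iff)
  qed
  then have eq: "smult ?b P = smult ?a Q" by simp
  then have "content (smult ?b P) = content (smult ?a Q)" by simp
  then have "?b = ?a"
    using P Q pos by (simp add: is_min_int_poly_def)
  with eq have "?a * coeff P i = ?a * coeff Q i" for i
    by (metis coeff_smult)
  then show ?thesis
    using nz by (intro poly_eqI) auto
qed

lemma is_min_int_poly_ex1:
  assumes "algebraic \<alpha>"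
  shows "\<exists>!P. is_min_int_poly \<alpha> P"
proof -
  obtain p where p: "\<And>i. coeff p i \<in> \<int>" "p \<noteq> 0" "poly p \<alpha> = 0"
    using assms by (auto simp: algebraic_def)
  define Q0 where "Q0 = map_poly (floor :: real \<Rightarrow> int) p"
  have "map_poly of_int Q0 = p"
    using p(1) by (intro poly_eqI) (simp add: Q0_def coeff_map_poly)
  with p have "Q0 \<noteq> 0 \<and> int_poly_eval Q0 \<alpha> = 0"
    by auto
  then obtain Q where Q: "Q \<noteq> 0" "int_poly_eval Q \<alpha> = 0"
    and least: "\<And>R. R \<noteq> 0 \<Longrightarrow> int_poly_eval R \<alpha> = 0 \<Longrightarrow> degree Q \<le> degree R"
    using ex_has_least_nat[of "\<lambda>Q. Q \<noteq> 0 \<and> int_poly_eval Q \<alpha> = 0" Q0 degree] by blast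
  define P where "P = smult (sgn (lead_coeff Q)) (primitive_part Q)"
  have sgn: "sgn (lead_coeff Q) \<noteq> 0"
    using Q by (simp add: sgn_if)
  have Q_eq: "Q = smult (content Q) (primitive_part Q)"
    by simp
  have cpos: "content Q > 0"
    using Q by (metis content_eq_zero_iff normalize_content normalize_int_def abs_ge_zero
        order_le_imp_less_or_eq)
  have "int_poly_eval (primitive_part Q) \<alpha> = 0"
    using Q cpos int_poly_eval_smult[of "content Q" "primitive_part Q" \<alpha>] by simp
  then have "int_poly_eval P \<alpha> = 0"
    by (simp add: P_def int_poly_eval_smult)
  moreover have "content P = 1"
    using Q sgn by (simp add: P_def sgn_if)
  moreover have "degree P = degree Q"
    using sgn by (simp add: P_def)
  moreover have "lead_coeff P > 0"
  proof -
    have "lead_coeff Q = content Q * lead_coeff (primitive_part Q)"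
      by (metis Q_eq lead_coeff_smult)
    then have "sgn (lead_coeff Q) = sgn (lead_coeff (primitive_part Q))"
      using cpos by (simp add: sgn_mult)
    then have "lead_coeff P = \<bar>lead_coeff (primitive_part Q)\<bar>"
      by (simp add: P_def abs_sgn mult.commute)
    then show ?thesis
      using Q by (metis leading_coeff_0_iff primitive_part_eq_0_iff zero_less_abs_iff)
  qed
  ultimately have "is_min_int_poly \<alpha> P"
    using least by (auto simp: is_min_int_poly_def)
  then show ?thesis
    using is_min_int_poly_unique by blast
qed

definition w_exp :: "nat \<Rightarrow> real \<Rightarrow> ereal" where
  "w_exp n \<xi> = Sup (ereal ` {w. infinite {P. degree P \<le> n \<and>
     0 < \<bar>int_poly_eval P \<xi>\<bar> \<and>
     \<bar>int_poly_eval P \<xi>\<bar> \<le> real_of_int (int_poly_height P) powr (- w)}})"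

definition w_star_exp :: "nat \<Rightarrow> real \<Rightarrow> ereal" where
  "w_star_exp n \<xi> = Sup (ereal ` {w. infinite {\<alpha>. algebraic \<alpha> \<and> alg_degree \<alpha> \<le> n \<and>
     0 < \<bar>\<xi> - \<alpha>\<bar> \<and>
     \<bar>\<xi> - \<alpha>\<bar> \<le> real_of_int (alg_height \<alpha>) powr (- w - 1)}})"

definition w_hat_exp :: "nat \<Rightarrow> real \<Rightarrow> ereal" where
  "w_hat_exp n \<xi> = Sup (ereal ` {w. \<forall>\<^sub>F X in at_top. \<exists>x :: nat \<Rightarrow> int.
     0 < \<bar>\<Sum>m\<le>n. real_of_int (x m) * \<xi> ^ m\<bar> \<and>
     \<bar>\<Sum>m\<le>n. real_of_int (x m) * \<xi> ^ m\<bar> \<le> X powr (- w) \<and>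
     real_of_int (MAX m\<in>{..n}. \<bar>x m\<bar>) \<le> X})"

definition w_hat_star_exp :: "nat \<Rightarrow> real \<Rightarrow> ereal" where
  "w_hat_star_exp n \<xi> = Sup (ereal ` {w. \<forall>\<^sub>F X in at_top. \<exists>\<alpha>.
     algebraic \<alpha> \<and> alg_degree \<alpha> \<le> n \<and>
     0 < \<bar>\<xi> - \<alpha>\<bar> \<and>
     \<bar>\<xi> - \<alpha>\<bar> \<le> inverse (real_of_int (alg_height \<alpha>)) * X powr (- w) \<and>
     real_of_int (alg_height \<alpha>) \<le> X})"

text \<open>The quotient \<open>w / (w - n + 1)\<close>, read as its limit \<open>1\<close> at \<open>w = \<infinity>\<close>
  (on type \<^typ>\<open>ereal\<close>, \<open>\<infinity> / \<infinity> = 0\<close>).\<close>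

definition transfer_bound :: "nat \<Rightarrow> ereal \<Rightarrow> ereal" where
  "transfer_bound n w = (if w = \<infinity> then 1 else w / (w - ereal (real n) + 1))"

end

theory Submission
  imports Defs "Berlekamp_Zassenhaus.Factor_Bound"
begin

text \<open>
  Fix parameters \<open>X\<close> and \<open>Y\<close>. The pigeonhole principle yields a nonzero integer polynomial \<open>P\<close> of degree
  at most \<open>n\<close> with \<open>|P(\<xi>)| \<lesssim> 1 / (X Y\<^bsup>n-1\<^esup>)\<close>, \<open>|P'(\<xi>)| \<lesssim> X\<close> and all coefficients of index at least \<open>2\<close>
  bounded by \<open>Y\<close>. If \<open>|P'(\<xi>)| \<lesssim> Y\<close>, then \<open>P\<close> has height \<open>\<lesssim> Y\<close>. Otherwise \<open>P'\<close> dominates the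
  second-order terms, so \<open>P\<close> has a real root \<open>\<alpha>\<close> with \<open>|\<xi> - \<alpha>| \<lesssim> |P(\<xi>)| / |P'(\<xi>)|\<close>, and
  \<open>H(\<alpha>) \<lesssim> H(P) \<lesssim> |P'(\<xi>)|\<close> by Mignotte's factor bound. With \<open>X = Y\<^bsup>w-n+1\<^esup>\<close> the first case reads
  \<open>|P(\<xi>)| \<lesssim> Y\<^bsup>-w\<^esup>\<close>: for \<open>w > w\<^sub>n(\<xi>)\<close> it fails for all large \<open>Y\<close>, for \<open>w\<close> above the uniform exponent it
  fails for arbitrarily large \<open>Y\<close>. The second case then gives the exponent \<open>1 + (n - 1) / (w - n + 1) =
  w / (w - n + 1)\<close>. If the exponent is infinite, take \<open>Y = 1\<close>.
\<close>

hide_const (open) up_ring.coeff up_ring.monom module.smult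

section \<open>Heights of integer polynomials and of their factors\<close>

lemma abs_coeff_le_height: "\<bar>coeff P i\<bar> \<le> int_poly_height P"
proof (cases "i \<le> degree P")
  case True
  then show ?thesis unfolding int_poly_height_def by (intro Max_ge) auto
next
  case False
  have "0 \<le> \<bar>coeff P 0\<bar>" by simp
  also have "\<dots> \<le> int_poly_height P" unfolding int_poly_height_def by (intro Max_ge) auto
  finally show ?thesis using False by (simp add: coeff_eq_0)
qed

lemma int_poly_height_leI:
  assumes "\<And>i. i \<le> degree P \<Longrightarrow> real_of_int \<bar>coeff P i\<bar> \<le> c"
  shows "real_of_int (int_poly_height P) \<le> c"
proof -
  have "int_poly_height P \<in> (\<lambda>i. \<bar>coeff P i\<bar>) ` {..degree P}"
    unfolding int_poly_height_def by (intro Max_in) auto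
  with assms show ?thesis by auto
qed

lemma int_poly_height_ge_1: "P \<noteq> 0 \<Longrightarrow> 1 \<le> int_poly_height P"
  using abs_coeff_le_height[of P "degree P"] leading_coeff_0_iff[of P] by linarith

text \<open>Mignotte's bound controls the coefficients of a factor by the Mahler measure of
  \<open>f\<close>, which Landau's inequality bounds by the Euclidean norm of the coefficients. In
  \<open>n + 2\<close>, the part \<open>n + 1\<close> comes from that norm and the remaining 1 from
  the leading coefficient.\<close>

lemma int_poly_height_factor_le:
  assumes "f \<noteq> 0" "g dvd f" "degree f \<le> n"
  shows "real_of_int (int_poly_height g) \<le> (real n + 2) * 2 ^ n * real_of_int (int_poly_height f)"
proof (rule int_poly_height_leI)
  fix k
  let ?H = "real_of_int (int_poly_height f)"
  have H: "?H \<ge> 1" using int_poly_height_ge_1[OF assms(1)] by simp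
  have le: "real_of_int \<bar>coeff f i\<bar> \<le> ?H" for i
    using abs_coeff_le_height by (simp only: of_int_le_iff)
  have g: "degree g \<le> n" using dvd_imp_degree_le[OF assms(2,1)] assms(3) by simp
  have sq: "(\<Sum>a\<leftarrow>coeffs f. a * a) = (\<Sum>i\<le>degree f. coeff f i * coeff f i)"
    using assms(1) by (simp add: coeffs_def o_def interv_sum_list_conv_sum_set_nat
        lessThan_Suc_atMost atLeast0LessThan del: upt_Suc)
  have "mahler_measure f \<le> sqrt (real_of_int (\<Sum>a\<leftarrow>coeffs f. a * a))"
    by (rule Landau_inequality_mahler_measure)
  also have "\<dots> \<le> sqrt (((real n + 1) * ?H)\<^sup>2)"
  proof (rule real_sqrt_le_mono)
    have "real_of_int (\<Sum>a\<leftarrow>coeffs f. a * a) = (\<Sum>i\<le>degree f. real_of_int \<bar>coeff f i\<bar> * real_of_int \<bar>coeff f i\<bar>)"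
      unfolding sq by simp
    also have "\<dots> \<le> (\<Sum>i\<le>degree f. ?H * ?H)"
      using le H by (intro sum_mono mult_mono) auto
    also have "\<dots> \<le> (real n + 1) * (?H * ?H)"
      using assms(3) H by simp
    \<comment> \<open>The crude passage from \<open>n + 1\<close> to its square lets the square root
      be taken exactly.\<close>
    also have "\<dots> \<le> (real n + 1)\<^sup>2 * (?H * ?H)"
      by (intro mult_right_mono) (auto simp: power2_eq_square)
    finally show "real_of_int (\<Sum>a\<leftarrow>coeffs f. a * a) \<le> ((real n + 1) * ?H)\<^sup>2"
      by (simp add: power2_eq_square mult_ac)
  qed
  finally have M: "mahler_measure f \<le> (real n + 1) * ?H"
    using H by simp
  have binom: "real (m choose j) \<le> 2 ^ n" if "m \<le> n" for m j
  proof -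
    have "m choose j \<le> 2 ^ m" by (rule binomial_le_pow2)
    also have "\<dots> \<le> 2 ^ n" using that by simp
    finally have "real (m choose j) \<le> real (2 ^ n)" by (rule of_nat_mono)
    then show ?thesis by simp
  qed
  have "\<bar>coeff g k\<bar> \<le> \<lfloor>real (n - 1 choose k) * mahler_measure f\<rfloor> +
       int (min k 1 * (n - 1 choose (k - 1))) * \<bar>lead_coeff f\<bar>"
    by (rule mignotte_bound_main[OF assms(1,2) g])
  then have "real_of_int \<bar>coeff g k\<bar> \<le> real_of_int (\<lfloor>real (n - 1 choose k) * mahler_measure f\<rfloor> +
       int (min k 1 * (n - 1 choose (k - 1))) * \<bar>lead_coeff f\<bar>)"
    by (simp only: of_int_le_iff)
  also have "\<dots> = real_of_int \<lfloor>real (n - 1 choose k) * mahler_measure f\<rfloor> +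
       real (min k 1 * (n - 1 choose (k - 1))) * real_of_int \<bar>lead_coeff f\<bar>"
    by (simp only: of_int_add of_int_mult of_int_of_nat_eq)
  also have "\<dots> \<le> 2 ^ n * ((real n + 1) * ?H) + 2 ^ n * ?H"
  proof (intro add_mono mult_mono)
    have "real_of_int \<lfloor>real (n - 1 choose k) * mahler_measure f\<rfloor>
      \<le> real (n - 1 choose k) * mahler_measure f" by simp
    also have "\<dots> \<le> 2 ^ n * ((real n + 1) * ?H)"
      using M binom[of "n - 1" k] mahler_measure_ge_0[of f] by (intro mult_mono) auto
    finally show "real_of_int \<lfloor>real (n - 1 choose k) * mahler_measure f\<rfloor>
      \<le> 2 ^ n * ((real n + 1) * ?H)" .
    show "real (min k 1 * (n - 1 choose (k - 1))) \<le> 2 ^ n"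
      using binom[of "n - 1" "k - 1"] by (cases k) auto
    show "real_of_int \<bar>lead_coeff f\<bar> \<le> ?H"
      by (rule le)
  qed auto
  finally show "real_of_int \<bar>coeff g k\<bar> \<le> (real n + 2) * 2 ^ n * ?H"
    by (simp add: algebra_simps)
qed

section \<open>Minimal polynomials of roots\<close>

lemma is_min_int_poly_min_int_poly: "algebraic \<alpha> \<Longrightarrow> is_min_int_poly \<alpha> (min_int_poly \<alpha>)"
  unfolding min_int_poly_def by (rule theI') (rule is_min_int_poly_ex1)

lemma algebraic_int_poly_root:
  assumes "P \<noteq> 0" "int_poly_eval P \<alpha> = 0"
  shows "algebraic \<alpha>"
  using assms by (intro algebraicI[of "map_poly of_int P"]) (auto simp: coeff_map_poly)

text \<open>The pseudo-remainder vanishes at \<alpha> and is zero or of degree below that of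
  \<open>Q\<close>, hence zero by minimality. Thus \<open>Q\<close> divides a constant multiple of
  \<open>P\<close>, and Gauss's lemma removes the constant because \<open>Q\<close> is
  primitive.\<close>

lemma is_min_int_poly_dvd:
  assumes Q: "is_min_int_poly \<alpha> Q" and P: "int_poly_eval P \<alpha> = 0"
  shows "Q dvd P"
proof -
  have nz: "Q \<noteq> 0" using Q by (auto simp: is_min_int_poly_def)
  obtain a S where a: "a \<noteq> 0" and S: "smult a P = Q * S + pseudo_mod P Q"
    using pseudo_mod(1)[OF nz] by blast
  have "pseudo_mod P Q = smult a P - Q * S" using S by simp
  then have "int_poly_eval (pseudo_mod P Q) \<alpha> = 0"
    using P Q by (simp add: int_poly_eval_diff int_poly_eval_smult is_min_int_poly_def hom_distribs)
  then have "pseudo_mod P Q = 0"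
    using pseudo_mod(2)[OF nz, of P] Q unfolding is_min_int_poly_def by force
  with S have "smult a P = Q * S" by simp
  then have "primitive_part (smult a P) = primitive_part Q * primitive_part S"
    by (simp add: primitive_part_mult)
  moreover have "primitive_part Q = Q"
    using Q by (simp add: is_min_int_poly_def primitive_part_prim)
  ultimately have "Q dvd smult (sgn a) (primitive_part P)"
    by (metis dvd_triv_left primitive_part_smult_int)
  then have "Q dvd primitive_part P"
    using a by (simp add: dvd_smult_iff sgn_if split: if_splits)
  then show ?thesis
    by (metis content_times_primitive_part dvd_smult)
qed

text \<open>Turns a root of a small polynomial into an approximant of controlled degree and height:
  the minimal polynomial divides \<open>P\<close>, so the factor bound applies.\<close>

lemma alg_bounds_of_root:
  assumes "P \<noteq> 0" "int_poly_eval P \<alpha> = 0" "degree P \<le> n"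
  shows "algebraic \<alpha>" "alg_degree \<alpha> \<le> n" "1 \<le> alg_height \<alpha>"
    "real_of_int (alg_height \<alpha>) \<le> (real n + 2) * 2 ^ n * real_of_int (int_poly_height P)"
proof -
  show alg: "algebraic \<alpha>" using assms(1,2) by (rule algebraic_int_poly_root)
  note min = is_min_int_poly_min_int_poly[OF alg]
  show "alg_degree \<alpha> \<le> n"
    using min assms unfolding is_min_int_poly_def alg_degree_def by force
  have "min_int_poly \<alpha> \<noteq> 0" using min by (auto simp: is_min_int_poly_def)
  then show "1 \<le> alg_height \<alpha>" unfolding alg_height_def by (rule int_poly_height_ge_1)
  show "real_of_int (alg_height \<alpha>) \<le> (real n + 2) * 2 ^ n * real_of_int (int_poly_height P)"
    unfolding alg_height_def
    by (rule int_poly_height_factor_le[OF assms(1) is_min_int_poly_dvd[OF min assms(2)] assms(3)])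
qed

section \<open>Value and derivative as linear forms, and small polynomials by pigeonhole\<close>

lemma int_poly_eval_altdef:
  assumes "degree P \<le> n"
  shows "int_poly_eval P x = (\<Sum>i\<le>n. real_of_int (coeff P i) * x ^ i)"
proof -
  have "int_poly_eval P x = (\<Sum>i\<le>degree P. real_of_int (coeff P i) * x ^ i)"
    by (simp add: poly_altdef degree_map_poly coeff_map_poly)
  also have "\<dots> = (\<Sum>i\<le>n. real_of_int (coeff P i) * x ^ i)"
    using assms by (intro sum.mono_neutral_left) (auto simp: coeff_eq_0)
  finally show ?thesis .
qed

lemma int_poly_eval_pderiv_altdef:
  assumes "degree P \<le> n"
  shows "int_poly_eval (pderiv P) x = (\<Sum>i\<le>n. real_of_int (coeff P i) * (real i * x ^ (i - 1)))"
proof -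
  let ?h = "\<lambda>i. real_of_int (coeff P i) * (real i * x ^ (i - 1))"
  have "degree (pderiv P) \<le> n" using assms by (simp add: degree_pderiv)
  then have "int_poly_eval (pderiv P) x = (\<Sum>i\<le>n. ?h (Suc i))"
    by (subst int_poly_eval_altdef) (auto simp: coeff_pderiv mult_ac)
  \<comment> \<open>The added terms at 0 and \<open>Suc n\<close> vanish, the former through the
    factor \<open>real i\<close>, the latter by the degree bound.\<close>
  also have "\<dots> = (\<Sum>i\<le>Suc n. ?h i)" by (subst sum.atMost_Suc_shift) simp
  also have "\<dots> = (\<Sum>i\<le>n. ?h i)" using assms by (simp add: coeff_eq_0)
  finally show ?thesis .
qed

text \<open>Coefficients 0 and 1 are controlled through the value and the derivative at \<xi>, the
  others one by one; hence the cut at index 2.\<close>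

lemma sum_atMost_split_two:
  fixes h :: "nat \<Rightarrow> real"
  assumes "n \<ge> 1"
  shows "(\<Sum>i\<le>n. h i) = h 0 + h 1 + (\<Sum>i=2..n. h i)"
proof -
  have "{..n} = insert 0 (insert 1 {2..n})" using assms by auto
  then show ?thesis by simp
qed


lemma ex_int_poly_coeffs: "\<exists>P :: int poly. degree P \<le> n \<and> (\<forall>i\<le>n. coeff P i = x i)"
proof -
  let ?P = "\<Sum>i\<le>n. monom (x i) i"
  have c: "coeff ?P j = (if j \<le> n then x j else 0)" for j
    by (simp add: coeff_sum)
  then have "degree ?P \<le> n" by (intro degree_le) auto
  with c show ?thesis by auto
qed

text \<open>Passing from \<open>i\<close> to \<open>Suc i\<close> multiplies the error by
  \<open>x + t\<close>, which is at most \<open>\<bar>x\<bar> + 1\<close> in size; the linear term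
  times \<open>t\<close> contributes one more multiple of \<open>t\<^sup>2\<close>.\<close>

lemma power_taylor_bound:
  fixes x :: real
  shows "\<exists>c\<ge>0. \<forall>t. \<bar>t\<bar> \<le> 1 \<longrightarrow> \<bar>(x + t) ^ i - x ^ i - real i * x ^ (i - 1) * t\<bar> \<le> c * t\<^sup>2"
proof (induction i)
  case 0
  then show ?case by (intro exI[of _ 0]) auto
next
  case (Suc i)
  then obtain c where c: "c \<ge> 0"
    "\<And>t. \<bar>t\<bar> \<le> 1 \<Longrightarrow> \<bar>(x + t) ^ i - x ^ i - real i * x ^ (i - 1) * t\<bar> \<le> c * t\<^sup>2" by blast
  let ?c = "(\<bar>x\<bar> + 1) * c + \<bar>real i * x ^ (i - 1)\<bar>"
  have "\<bar>(x + t) ^ Suc i - x ^ Suc i - real (Suc i) * x ^ (Suc i - 1) * t\<bar> \<le> ?c * t\<^sup>2"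
    if t: "\<bar>t\<bar> \<le> 1" for t
  proof -
    have "(x + t) ^ Suc i - x ^ Suc i - real (Suc i) * x ^ (Suc i - 1) * t
       = (x + t) * ((x + t) ^ i - x ^ i - real i * x ^ (i - 1) * t) + real i * x ^ (i - 1) * t\<^sup>2"
      by (cases i) (simp_all add: algebra_simps power2_eq_square)
    also have "\<bar>\<dots>\<bar> \<le> (\<bar>x\<bar> + 1) * (c * t\<^sup>2) + \<bar>real i * x ^ (i - 1)\<bar> * t\<^sup>2"
      using c(2)[OF t] t c(1)
      by (intro order_trans[OF abs_triangle_ineq] add_mono) (auto simp: abs_mult intro!: mult_mono)
    finally show ?thesis by (simp add: algebra_simps)
  qed
  moreover have "?c \<ge> 0" using c(1) by simp
  ultimately show ?case by blast
qed

text \<open>Only the value at \<xi> needs the pigeonhole: in suitable coordinates the derivative and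
  the coefficients from index 2 on are already bounded over a box of at least
  \<open>X * Y ^ (n - 1)\<close> points. Two points with close values give \<open>P\<close> as a
  difference.\<close>

lemma ex_small_int_poly:
  fixes X Y \<xi> :: real
  assumes n: "n \<ge> 1" and X: "X \<ge> 1" and Y: "Y \<ge> 1"
  shows "\<exists>P. P \<noteq> 0 \<and> degree P \<le> n \<and>
    \<bar>int_poly_eval P \<xi>\<bar> \<le> 2 / (X * Y ^ (n - 1)) \<and>
    \<bar>int_poly_eval (pderiv P) \<xi>\<bar> \<le> 2 * X \<and>
    (\<forall>i\<ge>2. real_of_int \<bar>coeff P i\<bar> \<le> Y)"
proof -
  \<comment> \<open>A point \<open>f\<close> of the box encodes the polynomial with coefficients \<open>f i\<close> for \<open>i \<ge> 2\<close>, with linear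
    coefficient chosen so that \<open>f 1\<close> is the integer part of its derivative at \<open>\<xi>\<close>, and with constant
    coefficient chosen so that its value at \<open>\<xi>\<close> lies in \<open>[0, 1)\<close>.\<close>
  define B where "B i = (if i = 1 then {0..\<lfloor>X\<rfloor>} else {0..\<lfloor>Y\<rfloor>})" for i :: nat
  define A where "A = PiE {1..n} B"
  define s where "s f = (\<Sum>i=2..n. real_of_int (f i) * (real i * \<xi> ^ (i - 1)))" for f :: "nat \<Rightarrow> int"
  define x1 where "x1 f = f 1 - \<lfloor>s f\<rfloor>" for f
  define t where "t f = real_of_int (x1 f) * \<xi> + (\<Sum>i=2..n. real_of_int (f i) * \<xi> ^ i)" for f
  define g where "g f i = (if i = 0 then - \<lfloor>t f\<rfloor> else if i = 1 then x1 f else f i)" for f and i :: nat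
  have val: "(\<Sum>i\<le>n. real_of_int (g f i) * \<xi> ^ i) = frac (t f)" for f
    by (subst sum_atMost_split_two[OF n]) (simp add: g_def t_def frac_def)
  have der: "(\<Sum>i\<le>n. real_of_int (g f i) * (real i * \<xi> ^ (i - 1))) = real_of_int (f 1) + frac (s f)" for f
    by (subst sum_atMost_split_two[OF n]) (simp add: g_def x1_def s_def frac_def)
  have cardA: "real (card A) = (real_of_int \<lfloor>X\<rfloor> + 1) * (real_of_int \<lfloor>Y\<rfloor> + 1) ^ (n - 1)"
  proof -
    have "{1..n} = insert 1 {2..n}" using n by auto
    then have "card A = card (B 1) * (\<Prod>i=2..n. card (B i))"
      unfolding A_def by (simp add: card_PiE)
    also have "(\<Prod>i=2..n. card (B i)) = (\<Prod>i=2..n. nat (\<lfloor>Y\<rfloor> + 1))"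
      by (intro prod.cong) (auto simp: B_def)
    also have "\<dots> = nat (\<lfloor>Y\<rfloor> + 1) ^ (n - 1)" by simp
    finally show ?thesis using X Y by (simp add: B_def)
  qed
  have fl: "\<lfloor>X\<rfloor> \<ge> 1" "\<lfloor>Y\<rfloor> \<ge> 1" using X Y by auto
  have big: "X * Y ^ (n - 1) \<le> real (card A)"
    unfolding cardA using X Y by (intro mult_mono power_mono zero_le_power) linarith+
  have "2 * 1 \<le> (real_of_int \<lfloor>X\<rfloor> + 1) * (real_of_int \<lfloor>Y\<rfloor> + 1) ^ (n - 1)"
    using fl by (intro mult_mono one_le_power) auto
  then have two: "2 \<le> card A" unfolding cardA[symmetric] by simp
  \<comment> \<open>With one interval fewer than points, two values share an interval. As
    \<open>card A\<close> is at least 2, \<open>N\<close> is at least half of it, which costs the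
    factor 2 in the value bound.\<close>
  define N where "N = card A - 1"
  have N: "N \<ge> 1" "real N = real (card A) - 1" using two by (auto simp: N_def)
  define b where "b f = \<lfloor>real N * frac (t f)\<rfloor>" for f
  have finA: "finite A" using two by (intro card_ge_0_finite) simp
  have "b f \<in> {0..<int N}" for f
    using N(1) frac_lt_1[of "t f"] frac_ge_0[of "t f"]
    by (auto simp: b_def floor_less_iff)
  then have "card (b ` A) \<le> card {0..<int N}" by (intro card_mono) auto
  also have "\<dots> < card A" using N two by (simp add: N_def)
  finally have "\<not> inj_on b A" by (rule pigeonhole)
  then obtain f h where fh: "f \<in> A" "h \<in> A" "f \<noteq> h" "b f = b h"
    by (auto simp: inj_on_def)
  obtain P where P: "degree P \<le> n" "\<And>i. i \<le> n \<Longrightarrow> coeff P i = g f i - g h i"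
    using ex_int_poly_coeffs[of n "\<lambda>i. g f i - g h i"] by blast
  have range: "0 \<le> k i" "real_of_int (k i) \<le> (if i = 1 then X else Y)" if "k \<in> A" "i \<in> {1..n}" for k i
    using PiE_mem[OF that(1)[unfolded A_def] that(2)] by (auto simp: B_def le_floor_iff split: if_splits)
  have vP: "int_poly_eval P \<xi> = frac (t f) - frac (t h)"
    unfolding val[symmetric] int_poly_eval_altdef[OF P(1)] by (simp add: P(2) sum_subtractf[symmetric] algebra_simps)
  have dP: "int_poly_eval (pderiv P) \<xi> =
      (real_of_int (f 1) + frac (s f)) - (real_of_int (h 1) + frac (s h))"
    unfolding der[symmetric] int_poly_eval_pderiv_altdef[OF P(1)] by (simp add: P(2) sum_subtractf[symmetric] algebra_simps)
  have "\<bar>real N * frac (t f) - real N * frac (t h)\<bar> \<le> 1"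
    using fh(4) unfolding b_def by linarith
  then have "real N * \<bar>frac (t f) - frac (t h)\<bar> \<le> 1"
    by (metis abs_mult abs_of_nat right_diff_distrib)
  then have "\<bar>frac (t f) - frac (t h)\<bar> \<le> 1 / real N"
    using N(1) by (simp add: field_simps)
  also have "\<dots> \<le> 2 / (X * Y ^ (n - 1))"
  proof -
    have "X * Y ^ (n - 1) \<le> 2 * real N" using big two N by linarith
    moreover have "X * Y ^ (n - 1) > 0" using X Y by simp
    ultimately show ?thesis using N(1) by (simp add: field_simps)
  qed
  finally have 1: "\<bar>frac (t f) - frac (t h)\<bar> \<le> 2 / (X * Y ^ (n - 1))" .
  \<comment> \<open>Both derivatives lie between 0 and \<open>X + 1\<close>, and
    \<open>X + 1 \<le> 2 * X\<close>.\<close>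
  have 2: "\<bar>(real_of_int (f 1) + frac (s f)) - (real_of_int (h 1) + frac (s h))\<bar> \<le> 2 * X"
  proof -
    have "0 \<le> real_of_int (f 1)" "real_of_int (f 1) \<le> X" "0 \<le> real_of_int (h 1)" "real_of_int (h 1) \<le> X"
      using range[OF fh(1), of 1] range[OF fh(2), of 1] n by auto
    then show ?thesis
      using X frac_lt_1[of "s f"] frac_ge_0[of "s f"] frac_lt_1[of "s h"] frac_ge_0[of "s h"]
      by linarith
  qed
  have 3: "real_of_int \<bar>coeff P i\<bar> \<le> Y" if "i \<ge> 2" for i
  proof (cases "i \<le> n")
    case True
    then show ?thesis
      using that range[OF fh(1), of i] range[OF fh(2), of i] P(2)[of i]
      by (auto simp: g_def abs_le_iff)
  next
    case False
    then show ?thesis using P(1) Y by (simp add: coeff_eq_0)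
  qed
  \<comment> \<open>The coefficients from index 2 on determine \<open>s\<close>, so coefficient 1
    then returns \<open>f 1\<close>; hence equal polynomials come from equal points.\<close>
  have "P \<noteq> 0"
  proof
    assume "P = 0"
    then have eq: "g f i = g h i" if "i \<le> n" for i using P(2)[OF that] by simp
    have big_i: "f i = h i" if "i \<in> {2..n}" for i using eq[of i] that by (auto simp: g_def)
    then have "s f = s h" unfolding s_def by (intro sum.cong) auto
    then have "f 1 = h 1" using eq[of 1] n by (simp add: g_def x1_def)
    then have "f i = h i" if "i \<in> {1..n}" for i
      using big_i[of i] that by (cases "i = 1") auto
    then have "f = h" using fh(1,2) unfolding A_def by (intro PiE_ext)
    with fh(3) show False by simp
  qed
  with P(1) 1 2 3 show ?thesis unfolding vP[symmetric] dP[symmetric] by blast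
qed

section \<open>Height and nearby roots from the value, the derivative and the higher
  coefficients\<close>

lemma abs_sum_mult_le:
  fixes a b :: "nat \<Rightarrow> real"
  assumes "\<And>i. i \<in> A \<Longrightarrow> \<bar>a i\<bar> \<le> M"
  shows "\<bar>\<Sum>i\<in>A. a i * b i\<bar> \<le> M * (\<Sum>i\<in>A. \<bar>b i\<bar>)"
proof -
  have "\<bar>\<Sum>i\<in>A. a i * b i\<bar> \<le> (\<Sum>i\<in>A. \<bar>a i * b i\<bar>)" by (rule sum_abs)
  also have "\<dots> \<le> (\<Sum>i\<in>A. M * \<bar>b i\<bar>)"
    using assms by (intro sum_mono) (auto simp: abs_mult intro!: mult_right_mono)
  finally show ?thesis by (simp add: sum_distrib_left)
qed

text \<open>The system is triangular: the derivative bounds coefficient 1 in terms of those from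
  index 2 on, then the value bounds coefficient 0. The bound \<open>2 * M\<close> on the value
  accommodates the constant 2 of the pigeonhole step.\<close>

lemma int_poly_height_le_forms:
  fixes \<xi> :: real
  assumes n: "n \<ge> 1"
  shows "\<exists>E\<ge>1. \<forall>P M. degree P \<le> n \<longrightarrow> M \<ge> 1 \<longrightarrow> (\<forall>i\<ge>2. real_of_int \<bar>coeff P i\<bar> \<le> M) \<longrightarrow>
    \<bar>int_poly_eval P \<xi>\<bar> \<le> 2 * M \<longrightarrow> \<bar>int_poly_eval (pderiv P) \<xi>\<bar> \<le> M \<longrightarrow>
    real_of_int (int_poly_height P) \<le> E * M"
proof -
  define S where "S = (\<Sum>i=2..n. \<bar>real i * \<xi> ^ (i - 1)\<bar>)"
  define V where "V = (\<Sum>i=2..n. \<bar>\<xi> ^ i\<bar>)"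
  have SV: "S \<ge> 0" "V \<ge> 0" unfolding S_def V_def by (auto intro!: sum_nonneg)
  define E where "E = 2 + (1 + S) * (1 + \<bar>\<xi>\<bar>) + V"
  have E1: "1 + S \<le> (1 + S) * (1 + \<bar>\<xi>\<bar>)"
    using SV by (simp add: algebra_simps)
  have "real_of_int (int_poly_height P) \<le> E * M"
    if P: "degree P \<le> n" and M: "M \<ge> 1" and c: "\<And>i. i \<ge> 2 \<Longrightarrow> real_of_int \<bar>coeff P i\<bar> \<le> M"
      and v: "\<bar>int_poly_eval P \<xi>\<bar> \<le> 2 * M"
      and d: "\<bar>int_poly_eval (pderiv P) \<xi>\<bar> \<le> M" for P M
  proof (rule int_poly_height_leI)
    fix i :: nat
    have "\<bar>\<Sum>i=2..n. real_of_int (coeff P i) * (real i * \<xi> ^ (i - 1))\<bar> \<le> M * S"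
      unfolding S_def using c by (intro abs_sum_mult_le) auto
    with d[unfolded int_poly_eval_pderiv_altdef[OF P]] have c1: "\<bar>real_of_int (coeff P 1)\<bar> \<le> M * (1 + S)"
      by (subst (asm) sum_atMost_split_two[OF n]) (simp add: algebra_simps)
    have s: "\<bar>\<Sum>i=2..n. real_of_int (coeff P i) * \<xi> ^ i\<bar> \<le> M * V"
      unfolding V_def using c by (intro abs_sum_mult_le) auto
    have "\<bar>real_of_int (coeff P 1) * \<xi>\<bar> \<le> M * (1 + S) * \<bar>\<xi>\<bar>"
      unfolding abs_mult using c1 by (intro mult_right_mono) auto
    with v[unfolded int_poly_eval_altdef[OF P]] s have c0: "\<bar>real_of_int (coeff P 0)\<bar> \<le> 2 * M + M * (1 + S) * \<bar>\<xi>\<bar> + M * V"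
      by (subst (asm) sum_atMost_split_two[OF n]) (simp add: algebra_simps)
    consider "i = 0" | "i = 1" | "i \<ge> 2" by linarith
    then show "real_of_int \<bar>coeff P i\<bar> \<le> E * M"
    proof cases
      case 1
      have "2 * M + M * (1 + S) * \<bar>\<xi>\<bar> + M * V \<le> E * M"
        using M SV by (simp add: E_def algebra_simps)
      with c0 1 show ?thesis by simp
    next
      case 2
      have "1 + S \<le> E" using E1 SV unfolding E_def by linarith
      then have "M * (1 + S) \<le> M * E" using M by (intro mult_left_mono) auto
      with c1 2 show ?thesis by (simp add: mult.commute)
    next
      case 3
      have "1 \<le> E" using E1 SV unfolding E_def by linarith
      then have "1 * M \<le> E * M" using M by (intro mult_right_mono) auto
      with c[OF 3] show ?thesis by simp
    qed
  qed
  moreover have "E \<ge> 1" using E1 SV unfolding E_def by linarith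
  ultimately show ?thesis by blast
qed

text \<open>At distance \<open>r = 2 |P(\<xi>)| / |P'(\<xi>)|\<close> from \<xi> the linear term has
  size \<open>2 |P(\<xi>)|\<close> while the quadratic error stays below \<open>|P(\<xi>)|\<close>.
  So \<open>P\<close> has opposite signs at the two ends, and the intermediate value theorem gives a
  root.\<close>

lemma int_poly_root_near:
  fixes \<xi> :: real
  assumes n: "n \<ge> 1"
  shows "\<exists>K\<ge>4. \<forall>P Y. degree P \<le> n \<longrightarrow> Y \<ge> 1 \<longrightarrow> (\<forall>i\<ge>2. real_of_int \<bar>coeff P i\<bar> \<le> Y) \<longrightarrow>
    int_poly_eval P \<xi> \<noteq> 0 \<longrightarrow> \<bar>int_poly_eval P \<xi>\<bar> \<le> 2 \<longrightarrow>
    \<bar>int_poly_eval (pderiv P) \<xi>\<bar> > K * Y \<longrightarrow>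
    (\<exists>\<alpha>. int_poly_eval P \<alpha> = 0 \<and> \<bar>\<xi> - \<alpha>\<bar> \<le> 2 * \<bar>int_poly_eval P \<xi>\<bar> / \<bar>int_poly_eval (pderiv P) \<xi>\<bar>)"
proof -
  obtain c where c: "\<And>i. c i \<ge> 0" "\<And>i t. \<bar>t\<bar> \<le> 1 \<Longrightarrow>
      \<bar>(\<xi> + t) ^ i - \<xi> ^ i - real i * \<xi> ^ (i - 1) * t\<bar> \<le> c i * t\<^sup>2"
    using power_taylor_bound[of \<xi>] by metis
  define T where "T = (\<Sum>i=2..n. c i)"
  have T: "T \<ge> 0" unfolding T_def using c by (auto intro!: sum_nonneg)
  \<comment> \<open>The summand \<open>2 * T\<close> keeps the quadratic error at radius
    \<open>r\<close> below the value at \<xi>; the 4 forces \<open>\<bar>D\<bar> > 4\<close>, hence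
    \<open>r \<le> 1\<close>, as the Taylor bound requires.\<close>
  define K where "K = 2 * T + 4"
  have "\<exists>\<alpha>. int_poly_eval P \<alpha> = 0 \<and> \<bar>\<xi> - \<alpha>\<bar> \<le> 2 * \<bar>int_poly_eval P \<xi>\<bar> / \<bar>D\<bar>"
    if P: "degree P \<le> n" and Y: "Y \<ge> 1" and cf: "\<And>i. i \<ge> 2 \<Longrightarrow> real_of_int \<bar>coeff P i\<bar> \<le> Y"
      and nz: "int_poly_eval P \<xi> \<noteq> 0" and le2: "\<bar>int_poly_eval P \<xi>\<bar> \<le> 2"
      and D: "D = int_poly_eval (pderiv P) \<xi>" and big: "\<bar>D\<bar> > K * Y"
    for P Y D
  proof -
    let ?p = "int_poly_eval P"
    have tay: "\<bar>?p (\<xi> + t) - ?p \<xi> - D * t\<bar> \<le> T * Y * t\<^sup>2" if t: "\<bar>t\<bar> \<le> 1" for t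
    proof -
      let ?e = "\<lambda>i. (\<xi> + t) ^ i - \<xi> ^ i - real i * \<xi> ^ (i - 1) * t"
      have "?p (\<xi> + t) - ?p \<xi> - D * t = (\<Sum>i\<le>n. real_of_int (coeff P i) * ?e i)"
        unfolding int_poly_eval_altdef[OF P] D int_poly_eval_pderiv_altdef[OF P]
        by (simp add: sum_subtractf[symmetric] sum_distrib_left right_diff_distrib mult_ac)
      \<comment> \<open>The Taylor remainders of the powers 0 and 1 vanish, so only coefficients
        bounded by \<open>Y\<close> enter.\<close>
      also have "\<dots> = (\<Sum>i=2..n. real_of_int (coeff P i) * ?e i)"
        by (subst sum_atMost_split_two[OF n]) simp
      also have "\<bar>\<dots>\<bar> \<le> Y * (\<Sum>i=2..n. \<bar>?e i\<bar>)"
        using cf by (intro abs_sum_mult_le) auto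
      also have "\<dots> \<le> Y * (\<Sum>i=2..n. c i * t\<^sup>2)"
        using c(2)[OF t] Y by (intro mult_left_mono sum_mono) auto
      also have "\<dots> = T * Y * t\<^sup>2"
        by (simp add: T_def sum_distrib_left mult_ac)
      finally show ?thesis .
    qed
    have KY: "K * Y \<ge> 4" "K \<ge> 4" using T Y mult_mono[of 4 K 1 Y] by (auto simp: K_def)
    with big have Dpos: "\<bar>D\<bar> > 4" by linarith
    define r where "r = 2 * \<bar>?p \<xi>\<bar> / \<bar>D\<bar>"
    have r: "r > 0" "r \<le> 1" using nz le2 Dpos by (auto simp: r_def field_simps)
    have rD: "r * \<bar>D\<bar> = 2 * \<bar>?p \<xi>\<bar>" using Dpos by (simp add: r_def)
    have "T * Y * r\<^sup>2 < \<bar>?p \<xi>\<bar>"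
    proof -
      have "2 * (T * Y) < \<bar>D\<bar>" using big T Y by (simp add: K_def algebra_simps)
      then have "2 * (T * Y) * r < \<bar>D\<bar> * r" using r by (intro mult_strict_right_mono) auto
      then have a: "T * Y * r < \<bar>?p \<xi>\<bar>" using rD by (simp add: mult_ac)
      have "T * Y * r * r \<le> T * Y * r * 1" using r T Y by (intro mult_left_mono) auto
      with a show ?thesis by (simp add: power2_eq_square mult_ac)
    qed
    then have tr: "\<bar>?p (\<xi> + t) - ?p \<xi> - D * t\<bar> < \<bar>?p \<xi>\<bar>" if "t = r \<or> t = - r" for t
      using tay[of t] that r by auto
    have cont: "continuous_on A ?p" for A by (intro continuous_intros)
    have opp: "?p (\<xi> - r) * ?p (\<xi> + r) < 0"
    proof (cases "D > 0")
      case True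
      then have "D * r = 2 * \<bar>?p \<xi>\<bar>" using rD by (simp add: mult.commute)
      then have "?p (\<xi> + r) > 0" "?p (\<xi> - r) < 0" using tr[of r] tr[of "-r"] by auto
      then show ?thesis by (simp add: mult_neg_pos)
    next
      case False
      then have "D * r = - 2 * \<bar>?p \<xi>\<bar>" using rD by (simp add: mult.commute)
      then have "?p (\<xi> + r) < 0" "?p (\<xi> - r) > 0" using tr[of r] tr[of "-r"] by auto
      then show ?thesis by (simp add: mult_pos_neg)
    qed
    have "\<exists>\<alpha>. \<xi> - r \<le> \<alpha> \<and> \<alpha> \<le> \<xi> + r \<and> ?p \<alpha> = 0"
      using opp r IVT'[of ?p "\<xi> - r" 0 "\<xi> + r"] IVT2'[of ?p "\<xi> + r" 0 "\<xi> - r"] cont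
      by (auto simp: mult_less_0_iff)
    then obtain \<alpha> where "\<xi> - r \<le> \<alpha>" "\<alpha> \<le> \<xi> + r" "?p \<alpha> = 0" by blast
    then show ?thesis by (intro exI[of _ \<alpha>]) (auto simp: r_def abs_le_iff)
  qed
  moreover have "K \<ge> 4" using T by (simp add: K_def)
  ultimately show ?thesis by blast
qed

section \<open>The dichotomy between small polynomials and close algebraic numbers\<close>

definition has_small_int_poly :: "nat \<Rightarrow> real \<Rightarrow> real \<Rightarrow> real \<Rightarrow> bool" where
  "has_small_int_poly n \<xi> h \<epsilon> \<longleftrightarrow> (\<exists>P. P \<noteq> 0 \<and> degree P \<le> n \<and>
     real_of_int (int_poly_height P) \<le> h \<and> \<bar>int_poly_eval P \<xi>\<bar> \<le> \<epsilon>)"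

text \<open>The cases compare |P'(\<xi>)| with \<open>K * Y\<close>. The constant \<open>C\<close>
  is chosen before \<open>X\<close> and \<open>Y\<close>, so that these may later be tied together
  by a power and sent to infinity.\<close>

lemma small_poly_or_close_algebraic:
  fixes \<xi> :: real
  assumes n: "n \<ge> 1" and nroot: "\<forall>P. P \<noteq> 0 \<longrightarrow> degree P \<le> n \<longrightarrow> int_poly_eval P \<xi> \<noteq> 0"
  shows "\<exists>C\<ge>1. \<forall>X Y. 1 \<le> X \<longrightarrow> 1 \<le> Y \<longrightarrow>
    has_small_int_poly n \<xi> (C * Y) (C / (X * Y ^ (n - 1))) \<or>
    (\<exists>\<alpha>. algebraic \<alpha> \<and> alg_degree \<alpha> \<le> n \<and> 0 < \<bar>\<xi> - \<alpha>\<bar> \<and> 1 \<le> alg_height \<alpha> \<and>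
       real_of_int (alg_height \<alpha>) \<le> C * X \<and>
       \<bar>\<xi> - \<alpha>\<bar> \<le> inverse (real_of_int (alg_height \<alpha>)) * (C / (X * Y ^ (n - 1))))"
proof -
  let ?D = "\<lambda>P. int_poly_eval (pderiv P) \<xi>"
  obtain E where E: "E \<ge> 1" "\<And>P M. degree P \<le> n \<Longrightarrow> M \<ge> 1 \<Longrightarrow>
      (\<forall>i\<ge>2. real_of_int \<bar>coeff P i\<bar> \<le> M) \<Longrightarrow> \<bar>int_poly_eval P \<xi>\<bar> \<le> 2 * M \<Longrightarrow>
      \<bar>?D P\<bar> \<le> M \<Longrightarrow> real_of_int (int_poly_height P) \<le> E * M"
    using int_poly_height_le_forms[OF n, of \<xi>] by metis
  obtain K where K: "K \<ge> 4" "\<And>P Y. degree P \<le> n \<Longrightarrow> Y \<ge> 1 \<Longrightarrow>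
      (\<forall>i\<ge>2. real_of_int \<bar>coeff P i\<bar> \<le> Y) \<Longrightarrow>
      int_poly_eval P \<xi> \<noteq> 0 \<Longrightarrow> \<bar>int_poly_eval P \<xi>\<bar> \<le> 2 \<Longrightarrow> \<bar>?D P\<bar> > K * Y \<Longrightarrow>
      \<exists>\<alpha>. int_poly_eval P \<alpha> = 0 \<and> \<bar>\<xi> - \<alpha>\<bar> \<le> 2 * \<bar>int_poly_eval P \<xi>\<bar> / \<bar>?D P\<bar>"
    using int_poly_root_near[OF n, of \<xi>] by metis
  define G where "G = (real n + 2) * 2 ^ n"
  have G: "G \<ge> 1"
  proof -
    have "1 * 1 \<le> (real n + 2) * 2 ^ n" by (intro mult_mono) auto
    then show ?thesis by (simp add: G_def)
  qed
  have GE: "1 * 1 \<le> G * E" using G E(1) by (intro mult_mono) auto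
  \<comment> \<open>\<open>E * K\<close> bounds the height in the first case. In the second,
    \<open>G * E\<close> links the height of \<alpha> to the derivative, and the 4 is a 2 from the
    pigeonhole bound times a 2 from the distance to the root.\<close>
  define C where "C = E * K + 4 * (G * E)"
  have C: "C \<ge> E * K" "C \<ge> 4 * (G * E)" "C \<ge> 2"
  proof -
    have "E * K \<ge> 0" using E(1) K(1) by simp
    then show "C \<ge> E * K" "C \<ge> 4 * (G * E)" "C \<ge> 2" using GE by (auto simp: C_def)
  qed
  show ?thesis
  proof (intro exI[of _ C] conjI allI impI)
    show "C \<ge> 1" using C by simp
    fix X Y :: real
    assume X: "1 \<le> X" and Y: "1 \<le> Y"
    define W where "W = X * Y ^ (n - 1)"
    have W: "W \<ge> 1" unfolding W_def using X Y mult_mono[of 1 X 1 "Y ^ (n - 1)"] by auto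
    obtain P where P: "P \<noteq> 0" "degree P \<le> n" "\<bar>int_poly_eval P \<xi>\<bar> \<le> 2 / W"
      "\<bar>?D P\<bar> \<le> 2 * X" "\<forall>i\<ge>2. real_of_int \<bar>coeff P i\<bar> \<le> Y"
      using ex_small_int_poly[OF n X Y, of \<xi>] unfolding W_def by blast
    have "2 / W \<le> 2" using W by (simp add: field_simps)
    with P(3) have le2: "\<bar>int_poly_eval P \<xi>\<bar> \<le> 2" by linarith
    have nz: "int_poly_eval P \<xi> \<noteq> 0" using nroot P by blast
    have YK: "Y \<le> K * Y" "1 \<le> K * Y"
    proof -
      have "1 * Y \<le> K * Y" using K(1) Y by (intro mult_right_mono) auto
      then show "Y \<le> K * Y" "1 \<le> K * Y" using Y by linarith+
    qed
    have bound: "2 / W \<le> C / W" using C W by (intro divide_right_mono) auto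
    show "has_small_int_poly n \<xi> (C * Y) (C / (X * Y ^ (n - 1))) \<or>
    (\<exists>\<alpha>. algebraic \<alpha> \<and> alg_degree \<alpha> \<le> n \<and> 0 < \<bar>\<xi> - \<alpha>\<bar> \<and> 1 \<le> alg_height \<alpha> \<and>
       real_of_int (alg_height \<alpha>) \<le> C * X \<and>
       \<bar>\<xi> - \<alpha>\<bar> \<le> inverse (real_of_int (alg_height \<alpha>)) * (C / (X * Y ^ (n - 1))))"
    proof (cases "\<bar>?D P\<bar> \<le> K * Y")
      case True
      have "real_of_int (int_poly_height P) \<le> E * (K * Y)"
        using True YK P(2,5) le2 by (intro E(2)) (auto intro: order_trans)
      also have "\<dots> \<le> C * Y" using C Y by (simp add: mult.assoc[symmetric] mult_right_mono)
      finally show ?thesis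
        using P order_trans[OF P(3) bound] unfolding W_def has_small_int_poly_def by blast
    next
      case False
      then have big: "\<bar>?D P\<bar> > K * Y" by simp
      obtain \<alpha> where \<alpha>: "int_poly_eval P \<alpha> = 0" "\<bar>\<xi> - \<alpha>\<bar> \<le> 2 * \<bar>int_poly_eval P \<xi>\<bar> / \<bar>?D P\<bar>"
        using K(2)[OF P(2) Y P(5) nz le2 big] by blast
      note alg = alg_bounds_of_root[OF P(1) \<alpha>(1) P(2)]
      let ?h = "real_of_int (alg_height \<alpha>)"
      have Dpos: "\<bar>?D P\<bar> \<ge> 1" using big YK by linarith
      \<comment> \<open>Here |P'(\<xi>)| exceeds \<open>Y\<close> and hence every coefficient from
        index 2 on, so it can itself serve as \<open>M\<close>.\<close>
      have "real_of_int (int_poly_height P) \<le> E * \<bar>?D P\<bar>"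
        using big YK P(2,5) le2 Dpos by (intro E(2)) (auto intro: order_trans)
      then have "G * real_of_int (int_poly_height P) \<le> G * (E * \<bar>?D P\<bar>)"
        using G by (intro mult_left_mono) auto
      with alg(4) have h: "?h \<le> G * E * \<bar>?D P\<bar>" by (simp only: G_def mult.assoc)
      also have "\<dots> \<le> G * E * (2 * X)" using P(4) GE by (intro mult_left_mono) auto
      also have "\<dots> \<le> C * X" using mult_right_mono[OF C(2), of X] GE X by simp
      finally have hX: "?h \<le> C * X" .
      have hpos: "?h \<ge> 1" using alg(3) by simp
      \<comment> \<open>The derivative cancels: it divides the distance and bounds the
        height.\<close>
      have "\<bar>\<xi> - \<alpha>\<bar> * ?h \<le> (2 * \<bar>int_poly_eval P \<xi>\<bar> / \<bar>?D P\<bar>) * (G * E * \<bar>?D P\<bar>)"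
        using \<alpha>(2) h hpos by (intro mult_mono) auto
      also have "\<dots> = 2 * (G * E) * \<bar>int_poly_eval P \<xi>\<bar>" using Dpos by simp
      also have "\<dots> \<le> 2 * (G * E) * (2 / W)" using P(3) GE by (intro mult_left_mono) auto
      also have "\<dots> = 4 * (G * E) / W" by simp
      also have "\<dots> \<le> C / W" using C W by (intro divide_right_mono) auto
      finally have "\<bar>\<xi> - \<alpha>\<bar> \<le> C / W / ?h"
        using hpos by (subst pos_le_divide_eq) auto
      then have "\<bar>\<xi> - \<alpha>\<bar> \<le> inverse ?h * (C / W)" by (simp add: divide_inverse mult_ac)
      moreover have "0 < \<bar>\<xi> - \<alpha>\<bar>" using \<alpha>(1) nz by auto
      ultimately show ?thesis using alg hX unfolding W_def by blast
    qed
  qed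
qed

text \<open>The balanced box \<open>Y = X\<close>, used for the lower bound \<open>n\<close> on both
  polynomial exponents.\<close>

lemma dirichlet_int_poly:
  fixes \<xi> :: real
  assumes n: "n \<ge> 1"
  shows "\<exists>C\<ge>1. \<forall>X\<ge>1. has_small_int_poly n \<xi> (C * X) (C / X ^ n)"
proof -
  obtain E where E: "E \<ge> 1" "\<And>P M. degree P \<le> n \<Longrightarrow> M \<ge> 1 \<Longrightarrow>
      (\<forall>i\<ge>2. real_of_int \<bar>coeff P i\<bar> \<le> M) \<Longrightarrow> \<bar>int_poly_eval P \<xi>\<bar> \<le> 2 * M \<Longrightarrow>
      \<bar>int_poly_eval (pderiv P) \<xi>\<bar> \<le> M \<Longrightarrow> real_of_int (int_poly_height P) \<le> E * M"
    using int_poly_height_le_forms[OF n, of \<xi>] by metis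
  have "has_small_int_poly n \<xi> (2 * E * X) (2 * E / X ^ n)" if X: "X \<ge> 1" for X
  proof -
    have Xn: "X * X ^ (n - 1) = X ^ n" using n by (cases n) auto
    obtain P where P: "P \<noteq> 0" "degree P \<le> n" "\<bar>int_poly_eval P \<xi>\<bar> \<le> 2 / X ^ n"
      "\<bar>int_poly_eval (pderiv P) \<xi>\<bar> \<le> 2 * X" "\<forall>i\<ge>2. real_of_int \<bar>coeff P i\<bar> \<le> X"
      using ex_small_int_poly[OF n X X, of \<xi>] unfolding Xn by blast
    have pow: "X ^ n \<ge> 1" using X by simp
    then have "2 / X ^ n \<le> 2" by (simp add: field_simps)
    with P(3) X have "\<bar>int_poly_eval P \<xi>\<bar> \<le> 2 * (2 * X)" by linarith
    then have "real_of_int (int_poly_height P) \<le> E * (2 * X)"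
      using P X by (intro E(2)) (auto intro: order_trans)
    moreover have "2 / X ^ n \<le> 2 * E / X ^ n"
      using E(1) pow by (intro divide_right_mono) auto
    ultimately show ?thesis
      using P(1,2) order_trans[OF P(3)] unfolding has_small_int_poly_def
      by (intro exI[of _ P]) (auto simp: mult_ac)
  qed
  moreover have "2 * E \<ge> 1" using E(1) by simp
  ultimately show ?thesis by blast
qed

section \<open>Limits, absorption of constants and finiteness\<close>

text \<open>Exponents are suprema, so it suffices to reach every smaller positive \<open>u\<close>;
  the gap between \<open>u\<close> and \<open>v\<close> then absorbs multiplicative
  constants.\<close>

lemma ereal_le_of_less:
  assumes "v > 0" "\<And>u. 0 < u \<Longrightarrow> u < v \<Longrightarrow> ereal u \<le> z"
  shows "ereal v \<le> z"
proof -
  have "eventually (\<lambda>u. u \<in> {0<..<v}) (at_left v)"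
    using assms(1) by (rule eventually_at_left_real)
  then have "eventually (\<lambda>u. ereal u \<le> z) (at_left v)"
    by eventually_elim (use assms(2) in auto)
  then show ?thesis
    by (intro tendsto_upperbound[of "\<lambda>u. ereal u" "ereal v" "at_left v"]) (auto intro!: tendsto_intros)
qed

lemma eventually_const_mult_powr_le:
  fixes A p q :: real
  assumes "p < q"
  shows "eventually (\<lambda>X. A * X powr (- q) \<le> X powr (- p)) at_top"
proof -
  have "filterlim (\<lambda>X :: real. X powr (q - p)) at_top at_top"
    using assms by (intro real_powr_at_top) simp
  then have "eventually (\<lambda>X. A \<le> X powr (q - p)) at_top"
    by (simp add: filterlim_at_top)
  then show ?thesis
  proof eventually_elim
    case (elim X)
    then have "A * X powr (- q) \<le> X powr (q - p) * X powr (- q)"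
      by (intro mult_right_mono) auto
    then show ?case by (simp flip: powr_add)
  qed
qed

lemma eventually_const_mult_powr_less:
  fixes A q \<delta> :: real
  assumes "q > 0" "\<delta> > 0"
  shows "eventually (\<lambda>X. A * X powr (- q) < \<delta>) at_top"
proof -
  have "((\<lambda>X. A * X powr (- q)) \<longlongrightarrow> A * 0) at_top"
    using assms(1) by (intro tendsto_intros tendsto_neg_powr filterlim_ident) auto
  then show ?thesis using assms(2) by (intro order_tendstoD) auto
qed

lemma filterlim_divide_at_top:
  fixes C :: real
  assumes "C > 0"
  shows "filterlim (\<lambda>T. T / C) at_top at_top"
  unfolding divide_inverse using assms
  by (intro filterlim_at_top_mult_tendsto_pos[OF tendsto_const _ filterlim_ident]) auto

text \<open>Used to prove sets infinite: on a finite set of approximants the nonzero errors would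
  stay above some \<open>\<delta>\<close>, against the occurrence of arbitrarily small
  errors.\<close>

lemma finite_positive_lower_bound:
  fixes f :: "'a \<Rightarrow> real"
  assumes "finite S" "\<And>a. a \<in> S \<Longrightarrow> f a > 0"
  shows "\<exists>\<delta>>0. \<forall>a\<in>S. \<delta> \<le> f a"
  using assms
proof (induction S rule: finite_induct)
  case empty
  then show ?case by (intro exI[of _ 1]) auto
next
  case (insert x S)
  then obtain \<delta> where "\<delta> > 0" "\<forall>a\<in>S. \<delta> \<le> f a" by auto
  with insert.prems show ?case by (intro exI[of _ "min \<delta> (f x)"]) auto
qed

lemma finite_int_poly_bounded: "finite {P. degree P \<le> n \<and> real_of_int (int_poly_height P) \<le> h}"
proof (rule finite_subset)
  let ?F = "PiE {..n} (\<lambda>_. {-\<lfloor>h\<rfloor>..\<lfloor>h\<rfloor>})"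
  show "finite ((\<lambda>f. \<Sum>i\<le>n. monom (f i) i) ` ?F)"
    by (intro finite_imageI finite_PiE) auto
  show "{P. degree P \<le> n \<and> real_of_int (int_poly_height P) \<le> h} \<subseteq> (\<lambda>f. \<Sum>i\<le>n. monom (f i) i) ` ?F"
  proof
    fix P assume "P \<in> {P. degree P \<le> n \<and> real_of_int (int_poly_height P) \<le> h}"
    then have P: "degree P \<le> n" "int_poly_height P \<le> \<lfloor>h\<rfloor>" by (auto simp: le_floor_iff)
    have "coeff P i \<in> {-\<lfloor>h\<rfloor>..\<lfloor>h\<rfloor>}" for i
      using abs_coeff_le_height[of P i] P(2) by auto
    then have "restrict (coeff P) {..n} \<in> ?F" by auto
    moreover have "P = (\<Sum>i\<le>n. monom (restrict (coeff P) {..n} i) i)"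
      using poly_as_sum_of_monoms'[OF P(1)] by simp
    ultimately show "P \<in> (\<lambda>f. \<Sum>i\<le>n. monom (f i) i) ` ?F" by blast
  qed
qed

section \<open>Lower bounds for the polynomial exponents\<close>

lemma powr_neg_mono_base:
  fixes h H u :: real
  assumes "0 < h" "h \<le> H" "u \<ge> 0"
  shows "H powr (- u) \<le> h powr (- u)"
  using assms by (simp add: powr_mono2')

text \<open>A height \<open>H\<close> of at most \<open>C * X powr a\<close> turns the value bound
  \<open>C * X powr (- b)\<close> into \<open>H powr (- u)\<close>, the gap \<open>a * u < b\<close>
  absorbing the constants. Infinitely many polynomials occur because their nonzero values at \<xi>
  become arbitrarily small.\<close>

lemma w_exp_ge:
  fixes \<xi> :: real
  assumes nroot: "\<forall>P. P \<noteq> 0 \<longrightarrow> degree P \<le> n \<longrightarrow> int_poly_eval P \<xi> \<noteq> 0"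
    and C: "C \<ge> 1" and a: "a \<ge> 0" and u: "u > 0" and ab: "a * u < b"
    and small: "frequently (\<lambda>X. has_small_int_poly n \<xi> (C * X powr a) (C * X powr (- b))) at_top"
  shows "ereal u \<le> w_exp n \<xi>"
proof -
  let ?S = "{P. degree P \<le> n \<and> 0 < \<bar>int_poly_eval P \<xi>\<bar> \<and>
     \<bar>int_poly_eval P \<xi>\<bar> \<le> real_of_int (int_poly_height P) powr (- u)}"
  have b: "b > 0" using a u ab by (smt (verit) mult_nonneg_nonneg)
  have "infinite ?S"
  proof
    assume "finite ?S"
    then obtain \<delta> where \<delta>: "\<delta> > 0" "\<And>P. P \<in> ?S \<Longrightarrow> \<delta> \<le> \<bar>int_poly_eval P \<xi>\<bar>"
      using finite_positive_lower_bound[of ?S "\<lambda>P. \<bar>int_poly_eval P \<xi>\<bar>"] by auto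
    have "eventually (\<lambda>X. C * C powr u * X powr (- b) \<le> X powr (- (a * u))) at_top"
      using ab by (rule eventually_const_mult_powr_le)
    moreover have "eventually (\<lambda>X. C * X powr (- b) < \<delta>) at_top"
      using b \<delta>(1) by (rule eventually_const_mult_powr_less)
    moreover have "eventually (\<lambda>X :: real. X > 0) at_top" by (rule eventually_gt_at_top)
    ultimately have "frequently (\<lambda>X. has_small_int_poly n \<xi> (C * X powr a) (C * X powr (- b)) \<and>
        C * C powr u * X powr (- b) \<le> X powr (- (a * u)) \<and> C * X powr (- b) < \<delta> \<and> X > 0) at_top"
      using small by (intro frequently_eventually_frequently eventually_conj)
    then obtain X where X: "has_small_int_poly n \<xi> (C * X powr a) (C * X powr (- b))"
        "C * C powr u * X powr (- b) \<le> X powr (- (a * u))" "C * X powr (- b) < \<delta>" "X > 0"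
      by (auto dest: frequently_ex)
    from X(1) obtain P where P: "P \<noteq> 0" "degree P \<le> n" "real_of_int (int_poly_height P) \<le> C * X powr a"
        "\<bar>int_poly_eval P \<xi>\<bar> \<le> C * X powr (- b)"
      unfolding has_small_int_poly_def by blast
    have "C powr (- u) * (C * C powr u * X powr (- b)) \<le> C powr (- u) * X powr (- (a * u))"
      using X(2) by (intro mult_left_mono) auto
    then have "C * X powr (- b) \<le> (C * X powr a) powr (- u)"
      using C by (simp add: powr_mult powr_powr powr_minus field_simps)
    also have "\<dots> \<le> real_of_int (int_poly_height P) powr (- u)"
      using int_poly_height_ge_1[OF P(1)] P(3) u by (intro powr_neg_mono_base) auto
    finally have "P \<in> ?S" using P nroot by auto
    from \<delta>(2)[OF this] P(4) X(3) show False by linarith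
  qed
  then show ?thesis unfolding w_exp_def by (intro Sup_upper) auto
qed

text \<open>For the uniform exponent the height bound \<open>T\<close> is prescribed:
  \<open>X = (T / C) powr (1 / a)\<close> solves \<open>C * X powr a = T\<close> and tends to
  infinity with \<open>T\<close>, as \<open>a > 0\<close>.\<close>

lemma w_hat_exp_ge:
  fixes \<xi> :: real
  assumes nroot: "\<forall>P. P \<noteq> 0 \<longrightarrow> degree P \<le> n \<longrightarrow> int_poly_eval P \<xi> \<noteq> 0"
    and C: "C \<ge> 1" and a: "a > 0" and ab: "a * u < b"
    and small: "eventually (\<lambda>X. has_small_int_poly n \<xi> (C * X powr a) (C * X powr (- b))) at_top"
  shows "ereal u \<le> w_hat_exp n \<xi>"
proof -
  have "filterlim (\<lambda>T. T / C) at_top at_top"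
    using C by (intro filterlim_divide_at_top) auto
  then have lim: "filterlim (\<lambda>T. (T / C) powr (1 / a)) at_top at_top"
    using a by (intro filterlim_compose[OF real_powr_at_top]) auto
  have "eventually (\<lambda>T. has_small_int_poly n \<xi> (C * ((T / C) powr (1 / a)) powr a)
      (C * ((T / C) powr (1 / a)) powr (- b))) at_top"
    using lim small by (rule eventually_compose_filterlim[rotated])
  moreover have "eventually (\<lambda>T. C * C powr (b / a) * T powr (- (b / a)) \<le> T powr (- u)) at_top"
    using a ab by (intro eventually_const_mult_powr_le) (simp add: field_simps)
  moreover have "eventually (\<lambda>T :: real. T > 0) at_top" by (rule eventually_gt_at_top)
  ultimately have "\<forall>\<^sub>F T in at_top. \<exists>x :: nat \<Rightarrow> int.
     0 < \<bar>\<Sum>m\<le>n. real_of_int (x m) * \<xi> ^ m\<bar> \<and>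
     \<bar>\<Sum>m\<le>n. real_of_int (x m) * \<xi> ^ m\<bar> \<le> T powr (- u) \<and>
     real_of_int (MAX m\<in>{..n}. \<bar>x m\<bar>) \<le> T"
  proof eventually_elim
    case (elim T)
    have T1: "C * ((T / C) powr (1 / a)) powr a = T"
      using elim(3) C a by (simp add: powr_powr)
    have T2: "C * ((T / C) powr (1 / a)) powr (- b) = C * C powr (b / a) * T powr (- (b / a))"
      using elim(3) C a by (simp add: powr_powr powr_divide powr_minus field_simps)
    from elim(1) obtain P where P: "P \<noteq> 0" "degree P \<le> n" "real_of_int (int_poly_height P) \<le> T"
        "\<bar>int_poly_eval P \<xi>\<bar> \<le> T powr (- u)"
      unfolding has_small_int_poly_def T1 T2 using elim(2) by (meson order_trans)
    \<comment> \<open>The maximum runs over \<open>{..n}\<close>, the height only up to the degree;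
      the further coefficients are zero.\<close>
    have "(MAX m\<in>{..n}. \<bar>coeff P m\<bar>) \<le> int_poly_height P"
      by (intro Max.boundedI) (auto simp: abs_coeff_le_height)
    with P(3) have "real_of_int (MAX m\<in>{..n}. \<bar>coeff P m\<bar>) \<le> T" by linarith
    moreover have "int_poly_eval P \<xi> \<noteq> 0" using nroot P by blast
    ultimately show ?case
      using P unfolding int_poly_eval_altdef[OF P(2)] by (intro exI[of _ "coeff P"]) auto
  qed
  then show ?thesis unfolding w_hat_exp_def by (intro Sup_upper) auto
qed

section \<open>Lower bounds for the exponents of algebraic approximation\<close>

text \<open>Puts \<open>Y = X powr \<theta>\<close>, so that \<open>X * Y ^ (n - 1)\<close> becomes
  \<open>X powr v\<close>.\<close>

lemma small_poly_or_close_algebraic_powr: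
  fixes \<xi> :: real
  assumes n: "n \<ge> 1" and nroot: "\<forall>P. P \<noteq> 0 \<longrightarrow> degree P \<le> n \<longrightarrow> int_poly_eval P \<xi> \<noteq> 0"
    and \<theta>: "\<theta> \<ge> 0" and v: "v = 1 + (real n - 1) * \<theta>"
  shows "\<exists>C\<ge>1. \<forall>X\<ge>1. has_small_int_poly n \<xi> (C * X powr \<theta>) (C * X powr (- v)) \<or>
    (\<exists>\<alpha>. algebraic \<alpha> \<and> alg_degree \<alpha> \<le> n \<and> 0 < \<bar>\<xi> - \<alpha>\<bar> \<and> 1 \<le> alg_height \<alpha> \<and>
       real_of_int (alg_height \<alpha>) \<le> C * X \<and>
       \<bar>\<xi> - \<alpha>\<bar> \<le> inverse (real_of_int (alg_height \<alpha>)) * (C * X powr (- v)))"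
proof -
  obtain C where C: "C \<ge> 1" "\<And>X Y. 1 \<le> X \<Longrightarrow> 1 \<le> Y \<Longrightarrow>
    has_small_int_poly n \<xi> (C * Y) (C / (X * Y ^ (n - 1))) \<or>
    (\<exists>\<alpha>. algebraic \<alpha> \<and> alg_degree \<alpha> \<le> n \<and> 0 < \<bar>\<xi> - \<alpha>\<bar> \<and> 1 \<le> alg_height \<alpha> \<and>
       real_of_int (alg_height \<alpha>) \<le> C * X \<and>
       \<bar>\<xi> - \<alpha>\<bar> \<le> inverse (real_of_int (alg_height \<alpha>)) * (C / (X * Y ^ (n - 1))))"
    using small_poly_or_close_algebraic[OF n nroot] by blast
  have "C / (X * (X powr \<theta>) ^ (n - 1)) = C * X powr (- v)" if "X \<ge> 1" for X
  proof -
    have "(X powr \<theta>) ^ (n - 1) = X powr (\<theta> * real (n - 1))"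
      using that by (simp add: powr_powr flip: powr_realpow)
    then have "X * (X powr \<theta>) ^ (n - 1) = X powr v"
      using that n by (simp add: v powr_add of_nat_diff mult.commute)
    then show ?thesis by (simp add: powr_minus_divide)
  qed
  moreover have "X powr \<theta> \<ge> 1" if "X \<ge> 1" for X using that \<theta> by (simp add: ge_one_powr_ge_zero)
  ultimately show ?thesis using C by (metis (no_types, lifting))
qed

text \<open>If the first alternative fails for all large \<open>X\<close>, every large
  \<open>X\<close> yields an algebraic number of height at most \<open>C * X\<close>. The assumption
  ranges over all \<open>C\<close> because the constant comes from the dichotomy.\<close>

lemma w_hat_star_exp_ge:
  fixes \<xi> :: real
  assumes n: "n \<ge> 1" and nroot: "\<forall>P. P \<noteq> 0 \<longrightarrow> degree P \<le> n \<longrightarrow> int_poly_eval P \<xi> \<noteq> 0"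
    and \<theta>: "\<theta> \<ge> 0" and v: "v = 1 + (real n - 1) * \<theta>"
    and none: "\<And>C. C \<ge> 1 \<Longrightarrow>
      eventually (\<lambda>X. \<not> has_small_int_poly n \<xi> (C * X powr \<theta>) (C * X powr (- v))) at_top"
  shows "ereal v \<le> w_hat_star_exp n \<xi>"
proof (rule ereal_le_of_less)
  show "v > 0" using n \<theta> by (simp add: v add_pos_nonneg)
  fix u assume u: "0 < u" "u < v"
  obtain C where C: "C \<ge> 1" "\<And>X. X \<ge> 1 \<Longrightarrow> has_small_int_poly n \<xi> (C * X powr \<theta>) (C * X powr (- v)) \<or>
    (\<exists>\<alpha>. algebraic \<alpha> \<and> alg_degree \<alpha> \<le> n \<and> 0 < \<bar>\<xi> - \<alpha>\<bar> \<and> 1 \<le> alg_height \<alpha> \<and>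
       real_of_int (alg_height \<alpha>) \<le> C * X \<and>
       \<bar>\<xi> - \<alpha>\<bar> \<le> inverse (real_of_int (alg_height \<alpha>)) * (C * X powr (- v)))"
    using small_poly_or_close_algebraic_powr[OF n nroot \<theta> v] by blast
  \<comment> \<open>The parameter \<open>X = Z / C\<close> makes the height bound exactly
    \<open>Z\<close>; the resulting constant \<open>C * C powr v\<close> is absorbed by
    \<open>u < v\<close>.\<close>
  have lim: "filterlim (\<lambda>Z. Z / C) at_top at_top"
    using C by (intro filterlim_divide_at_top) auto
  have "eventually (\<lambda>Z. \<not> has_small_int_poly n \<xi> (C * (Z / C) powr \<theta>) (C * (Z / C) powr (- v))) at_top"
    using lim none[OF C(1)] by (rule eventually_compose_filterlim[rotated])
  moreover have "eventually (\<lambda>Z. C * C powr v * Z powr (- v) \<le> Z powr (- u)) at_top"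
    using u by (intro eventually_const_mult_powr_le)
  moreover have "eventually (\<lambda>Z. Z \<ge> C) at_top" by (rule eventually_ge_at_top)
  ultimately have "\<forall>\<^sub>F X in at_top. \<exists>\<alpha>. algebraic \<alpha> \<and> alg_degree \<alpha> \<le> n \<and> 0 < \<bar>\<xi> - \<alpha>\<bar> \<and>
     \<bar>\<xi> - \<alpha>\<bar> \<le> inverse (real_of_int (alg_height \<alpha>)) * X powr (- u) \<and>
     real_of_int (alg_height \<alpha>) \<le> X"
  proof eventually_elim
    case (elim Z)
    have "Z / C \<ge> 1" using elim(3) C(1) by (simp add: field_simps)
    from C(2)[OF this] elim(1) obtain \<alpha> where \<alpha>: "algebraic \<alpha>" "alg_degree \<alpha> \<le> n" "0 < \<bar>\<xi> - \<alpha>\<bar>"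
       "1 \<le> alg_height \<alpha>" "real_of_int (alg_height \<alpha>) \<le> C * (Z / C)"
       "\<bar>\<xi> - \<alpha>\<bar> \<le> inverse (real_of_int (alg_height \<alpha>)) * (C * (Z / C) powr (- v))" by blast
    have "C * (Z / C) powr (- v) = C * C powr v * Z powr (- v)"
      using elim(3) C(1) by (simp add: powr_divide powr_minus field_simps)
    with elim(2) have "C * (Z / C) powr (- v) \<le> Z powr (- u)" by (simp only:)
    then have "inverse (real_of_int (alg_height \<alpha>)) * (C * (Z / C) powr (- v))
      \<le> inverse (real_of_int (alg_height \<alpha>)) * Z powr (- u)"
      using \<alpha>(4) by (intro mult_left_mono) auto
    with \<alpha>(6) have "\<bar>\<xi> - \<alpha>\<bar> \<le> inverse (real_of_int (alg_height \<alpha>)) * Z powr (- u)" by (rule order_trans)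
    moreover have "real_of_int (alg_height \<alpha>) \<le> Z" using \<alpha>(5) C(1) by simp
    ultimately show ?case using \<alpha>(1-3) by blast
  qed
  then show "ereal u \<le> w_hat_star_exp n \<xi>"
    unfolding w_hat_star_exp_def by (intro Sup_upper) auto
qed

text \<open>Here failure for arbitrarily large \<open>X\<close> is enough. As the height of \<alpha>
  is at most \<open>C * X\<close>, the factor \<open>X powr (- v)\<close> is bounded by a power of
  that height; the distances become arbitrarily small, so infinitely many \<alpha> occur.\<close>

lemma w_star_exp_ge:
  fixes \<xi> :: real
  assumes n: "n \<ge> 1" and nroot: "\<forall>P. P \<noteq> 0 \<longrightarrow> degree P \<le> n \<longrightarrow> int_poly_eval P \<xi> \<noteq> 0"
    and \<theta>: "\<theta> \<ge> 0" and v: "v = 1 + (real n - 1) * \<theta>"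
    and none: "\<And>C. C \<ge> 1 \<Longrightarrow>
      frequently (\<lambda>X. \<not> has_small_int_poly n \<xi> (C * X powr \<theta>) (C * X powr (- v))) at_top"
  shows "ereal v \<le> w_star_exp n \<xi>"
proof (rule ereal_le_of_less)
  show v0: "v > 0" using n \<theta> by (simp add: v add_pos_nonneg)
  fix u assume u: "0 < u" "u < v"
  obtain C where C: "C \<ge> 1" "\<And>X. X \<ge> 1 \<Longrightarrow> has_small_int_poly n \<xi> (C * X powr \<theta>) (C * X powr (- v)) \<or>
    (\<exists>\<alpha>. algebraic \<alpha> \<and> alg_degree \<alpha> \<le> n \<and> 0 < \<bar>\<xi> - \<alpha>\<bar> \<and> 1 \<le> alg_height \<alpha> \<and>
       real_of_int (alg_height \<alpha>) \<le> C * X \<and>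
       \<bar>\<xi> - \<alpha>\<bar> \<le> inverse (real_of_int (alg_height \<alpha>)) * (C * X powr (- v)))"
    using small_poly_or_close_algebraic_powr[OF n nroot \<theta> v] by blast
  let ?S = "{\<alpha>. algebraic \<alpha> \<and> alg_degree \<alpha> \<le> n \<and> 0 < \<bar>\<xi> - \<alpha>\<bar> \<and>
     \<bar>\<xi> - \<alpha>\<bar> \<le> real_of_int (alg_height \<alpha>) powr (- u - 1)}"
  have "infinite ?S"
  proof
    assume "finite ?S"
    then obtain \<delta> where \<delta>: "\<delta> > 0" "\<And>\<alpha>. \<alpha> \<in> ?S \<Longrightarrow> \<delta> \<le> \<bar>\<xi> - \<alpha>\<bar>"
      using finite_positive_lower_bound[of ?S "\<lambda>\<alpha>. \<bar>\<xi> - \<alpha>\<bar>"] by auto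
    have "eventually (\<lambda>X. C * C powr u * X powr (- v) \<le> X powr (- u)) at_top"
      using u by (intro eventually_const_mult_powr_le)
    moreover have "eventually (\<lambda>X. C * X powr (- v) < \<delta>) at_top"
      using v0 \<delta>(1) by (rule eventually_const_mult_powr_less)
    moreover have "eventually (\<lambda>X :: real. X \<ge> 1) at_top" by (rule eventually_ge_at_top)
    ultimately have "frequently (\<lambda>X. \<not> has_small_int_poly n \<xi> (C * X powr \<theta>) (C * X powr (- v)) \<and>
        C * C powr u * X powr (- v) \<le> X powr (- u) \<and> C * X powr (- v) < \<delta> \<and> X \<ge> 1) at_top"
      using none[OF C(1)] by (intro frequently_eventually_frequently eventually_conj)
    then obtain X where X: "\<not> has_small_int_poly n \<xi> (C * X powr \<theta>) (C * X powr (- v))"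
        "C * C powr u * X powr (- v) \<le> X powr (- u)" "C * X powr (- v) < \<delta>" "X \<ge> 1"
      by (auto dest: frequently_ex)
    from C(2)[OF X(4)] X(1) obtain \<alpha> where \<alpha>: "algebraic \<alpha>" "alg_degree \<alpha> \<le> n" "0 < \<bar>\<xi> - \<alpha>\<bar>"
       "1 \<le> alg_height \<alpha>" "real_of_int (alg_height \<alpha>) \<le> C * X"
       "\<bar>\<xi> - \<alpha>\<bar> \<le> inverse (real_of_int (alg_height \<alpha>)) * (C * X powr (- v))" by blast
    let ?h = "real_of_int (alg_height \<alpha>)"
    have h: "?h \<ge> 1" using \<alpha>(4) by simp
    have "C powr (- u) * (C * C powr u * X powr (- v)) \<le> C powr (- u) * X powr (- u)"
      using X(2) by (intro mult_left_mono) auto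
    then have "C * X powr (- v) \<le> (C * X) powr (- u)"
      using C(1) X(4) by (simp add: powr_mult powr_minus field_simps)
    also have "\<dots> \<le> ?h powr (- u)"
      using h \<alpha>(5) u by (intro powr_neg_mono_base) auto
    finally have "inverse ?h * (C * X powr (- v)) \<le> inverse ?h * ?h powr (- u)"
      using h by (intro mult_left_mono) auto
    also have "\<dots> = ?h powr (- u - 1)"
      using h by (simp add: powr_diff field_simps)
    finally have "\<alpha> \<in> ?S" using \<alpha> by auto
    then have "\<delta> \<le> \<bar>\<xi> - \<alpha>\<bar>" by (rule \<delta>(2))
    \<comment> \<open>The height is at least 1, so the distance itself falls below
      \<open>\<delta>\<close>.\<close>
    moreover have "inverse ?h * (C * X powr (- v)) \<le> 1 * (C * X powr (- v))"
      using h C(1) by (intro mult_right_mono) (auto simp: field_simps)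
    ultimately show False using \<alpha>(6) X(3) by linarith
  qed
  then show "ereal u \<le> w_star_exp n \<xi>"
    unfolding w_star_exp_def by (intro Sup_upper) auto
qed

section \<open>Infinite exponents, passage to the limit, and the transfer inequalities\<close>

text \<open>Serves the choice \<open>\<theta> = 0\<close>, that is \<open>Y = 1\<close>: finitely
  many nonzero polynomials have bounded degree and height, so their values at \<xi> stay away from
  0.\<close>

lemma eventually_no_small_bounded_poly:
  fixes \<xi> :: real
  assumes nroot: "\<forall>P. P \<noteq> 0 \<longrightarrow> degree P \<le> n \<longrightarrow> int_poly_eval P \<xi> \<noteq> 0"
  shows "eventually (\<lambda>X. \<not> has_small_int_poly n \<xi> h (A * X powr (- 1))) at_top"
proof -
  let ?S = "{P. degree P \<le> n \<and> real_of_int (int_poly_height P) \<le> h} - {0}"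
  have "finite ?S" using finite_int_poly_bounded by blast
  then obtain \<delta> where \<delta>: "\<delta> > 0" "\<And>P. P \<in> ?S \<Longrightarrow> \<delta> \<le> \<bar>int_poly_eval P \<xi>\<bar>"
    using finite_positive_lower_bound[of ?S "\<lambda>P. \<bar>int_poly_eval P \<xi>\<bar>"] nroot by auto
  have "eventually (\<lambda>X. A * X powr (- 1) < \<delta>) at_top"
    using \<delta>(1) by (intro eventually_const_mult_powr_less) auto
  then show ?thesis
    by eventually_elim (use \<delta>(2) in \<open>force simp: has_small_int_poly_def\<close>)
qed

text \<open>The function \<open>w / (w - n + 1) = 1 + (n - 1) / (w - n + 1)\<close> is continuous
  for \<open>w \<ge> n\<close>, so real \<open>w\<close> above a finite \<open>W\<close> may
  decrease to \<open>W\<close>. No such \<open>w\<close> exists for infinite \<open>W\<close>,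
  whence the separate hypothesis.\<close>

lemma transfer_bound_le:
  assumes "ereal (real n) \<le> W"
    and inf: "W = \<infinity> \<Longrightarrow> 1 \<le> z"
    and fin: "\<And>w. W < ereal w \<Longrightarrow> real n < w \<Longrightarrow> ereal (1 + (real n - 1) * (1 / (w - real n + 1))) \<le> z"
  shows "transfer_bound n W \<le> z"
proof (cases W)
  case (real w0)
  then have w0: "real n \<le> w0" using assms(1) by simp
  have "((\<lambda>w. 1 + (real n - 1) * (1 / (w - real n + 1))) \<longlongrightarrow> 1 + (real n - 1) * (1 / (w0 - real n + 1))) (at_right w0)"
    using w0 by (intro tendsto_intros) auto
  moreover have "eventually (\<lambda>w. ereal (1 + (real n - 1) * (1 / (w - real n + 1))) \<le> z) (at_right w0)"
    using fin w0 real by (auto simp: eventually_at_right_field intro!: exI[of _ "w0 + 1"])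
  ultimately have "ereal (1 + (real n - 1) * (1 / (w0 - real n + 1))) \<le> z"
    by (intro tendsto_upperbound[of "\<lambda>w. ereal (1 + (real n - 1) * (1 / (w - real n + 1)))" _ "at_right w0"])
      (auto intro: tendsto_ereal)
  moreover have "1 + (real n - 1) * (1 / (w0 - real n + 1)) = w0 / (w0 - real n + 1)"
    using w0 by (simp add: field_simps)
  moreover have "transfer_bound n W = ereal (w0 / (w0 - real n + 1))"
    using w0 real by (simp add: transfer_bound_def one_ereal_def)
  ultimately show ?thesis by simp
\<comment> \<open>Minus infinity is excluded by the lower bound \<open>n\<close> on
  \<open>W\<close>; at infinity the bound is 1 by definition.\<close>
qed (use assms in \<open>auto simp: transfer_bound_def\<close>)

theorem theorem2p1:
  fixes n :: nat and \<xi> :: real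
  assumes "n \<ge> 1"
    and "\<not> (algebraic \<xi> \<and> alg_degree \<xi> \<le> n)"
  shows "w_hat_star_exp n \<xi> \<ge> transfer_bound n (w_exp n \<xi>) \<and>
         w_star_exp n \<xi> \<ge> transfer_bound n (w_hat_exp n \<xi>)"
proof -
  note n = assms(1)
  have nroot: "\<forall>P. P \<noteq> 0 \<longrightarrow> degree P \<le> n \<longrightarrow> int_poly_eval P \<xi> \<noteq> 0"
    using alg_bounds_of_root(1,2) assms(2) by blast
  obtain C0 where C0: "C0 \<ge> 1" "\<And>X. X \<ge> 1 \<Longrightarrow> has_small_int_poly n \<xi> (C0 * X) (C0 / X ^ n)"
    using dirichlet_int_poly[OF n] by blast
  have dirichlet: "eventually (\<lambda>X. has_small_int_poly n \<xi> (C0 * X powr 1) (C0 * X powr (- real n))) at_top"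
    using eventually_ge_at_top[of 1]
  proof eventually_elim
    case (elim X)
    then show ?case using C0(2)[OF elim] by (simp add: powr_minus_divide powr_realpow)
  qed
  \<comment> \<open>This keeps the denominator \<open>w - n + 1\<close> at least 1.\<close>
  have w_n: "ereal (real n) \<le> w_exp n \<xi>"
  proof (rule ereal_le_of_less)
    fix u assume "0 < u" "u < real n"
    then show "ereal u \<le> w_exp n \<xi>"
      using eventually_frequently[OF _ dirichlet] by (intro w_exp_ge[OF nroot C0(1), of 1 u "real n"]) auto
  qed (use n in simp)
  have w_hat_n: "ereal (real n) \<le> w_hat_exp n \<xi>"
  proof (rule ereal_le_of_less)
    fix u assume "0 < u" "u < real n"
    then show "ereal u \<le> w_hat_exp n \<xi>"
      by (intro w_hat_exp_ge[OF nroot C0(1) _ _ dirichlet]) auto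
  qed (use n in simp)
  \<comment> \<open>This \<open>\<theta>\<close> solves
    \<open>\<theta> * w = 1 + (n - 1) * \<theta>\<close>: for \<open>Y = X powr \<theta> w\<close>
    the first alternative has height of order \<open>Y\<close> and value of order
    \<open>Y powr (- w)\<close>.\<close>
  define \<theta> where "\<theta> w = 1 / (w - real n + 1)" for w
  have \<theta>: "\<theta> w > 0" "1 + (real n - 1) * \<theta> w = \<theta> w * w" if "real n < w" for w
    using that by (auto simp: \<theta>_def field_simps)
  \<comment> \<open>The intermediate \<open>u\<close> supplies the strict gap
    \<open>\<theta> w * u < \<theta> w * w\<close> in which constants are absorbed.\<close>
  have between: "\<exists>u>0. W < ereal u \<and> u < w" if W: "ereal (real n) \<le> W" "W < ereal w" for W w
  proof -
    obtain u where u: "W < ereal u" "ereal u < ereal w" using ereal_dense2[OF W(2)] by blast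
    have "ereal (real n) < ereal u" using W(1) u(1) by (rule order_le_less_trans)
    with u show ?thesis by (intro exI[of _ u]) auto
  qed
  have "transfer_bound n (w_exp n \<xi>) \<le> w_hat_star_exp n \<xi>"
  proof (rule transfer_bound_le[OF w_n])
    have "ereal 1 \<le> w_hat_star_exp n \<xi>"
    proof (rule w_hat_star_exp_ge[OF n nroot, of 0])
      fix C :: real
      show "eventually (\<lambda>X. \<not> has_small_int_poly n \<xi> (C * X powr 0) (C * X powr (- 1))) at_top"
        using eventually_no_small_bounded_poly[OF nroot, of C C] eventually_gt_at_top[of 0]
        by eventually_elim simp
    qed auto
    then show "1 \<le> w_hat_star_exp n \<xi>" by (simp add: one_ereal_def)
  next
    fix w assume w: "w_exp n \<xi> < ereal w" "real n < w"
    obtain u where u: "u > 0" "w_exp n \<xi> < ereal u" "u < w" using between[OF w_n w(1)] by blast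
    show "ereal (1 + (real n - 1) * (1 / (w - real n + 1))) \<le> w_hat_star_exp n \<xi>"
      unfolding \<theta>_def[symmetric]
    proof (rule w_hat_star_exp_ge[OF n nroot _ refl])
      fix C :: real assume C: "C \<ge> 1"
      \<comment> \<open>Such polynomials for arbitrarily large \<open>X\<close> would give
        \<open>w_exp n \<xi>\<close> at least \<open>u\<close>.\<close>
      have "\<not> frequently (\<lambda>X. has_small_int_poly n \<xi> (C * X powr \<theta> w) (C * X powr (- (\<theta> w * w)))) at_top"
        using w_exp_ge[OF nroot C, of "\<theta> w" u "\<theta> w * w"] u \<theta>(1)[OF w(2)] by auto
      then show "eventually (\<lambda>X. \<not> has_small_int_poly n \<xi> (C * X powr \<theta> w)
          (C * X powr (- (1 + (real n - 1) * \<theta> w)))) at_top"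
        unfolding \<theta>(2)[OF w(2)] by (simp add: not_frequently)
    qed (use \<theta>[OF w(2)] in auto)
  qed
  moreover have "transfer_bound n (w_hat_exp n \<xi>) \<le> w_star_exp n \<xi>"
  proof (rule transfer_bound_le[OF w_hat_n])
    have "ereal 1 \<le> w_star_exp n \<xi>"
    proof (rule w_star_exp_ge[OF n nroot, of 0])
      fix C :: real
      have "eventually (\<lambda>X. \<not> has_small_int_poly n \<xi> (C * X powr 0) (C * X powr (- 1))) at_top"
        using eventually_no_small_bounded_poly[OF nroot, of C C] eventually_gt_at_top[of 0]
        by eventually_elim simp
      then show "frequently (\<lambda>X. \<not> has_small_int_poly n \<xi> (C * X powr 0) (C * X powr (- 1))) at_top"
        by (intro eventually_frequently) auto
    qed auto
    then show "1 \<le> w_star_exp n \<xi>" by (simp add: one_ereal_def)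
  next
    fix w assume w: "w_hat_exp n \<xi> < ereal w" "real n < w"
    obtain u where u: "u > 0" "w_hat_exp n \<xi> < ereal u" "u < w" using between[OF w_hat_n w(1)] by blast
    show "ereal (1 + (real n - 1) * (1 / (w - real n + 1))) \<le> w_star_exp n \<xi>"
      unfolding \<theta>_def[symmetric]
    proof (rule w_star_exp_ge[OF n nroot _ refl])
      fix C :: real assume C: "C \<ge> 1"
      \<comment> \<open>The uniform exponent needs small polynomials for all large \<open>X\<close>,
        so the contrapositive yields failure only for arbitrarily large \<open>X\<close>; this
        suffices for \<open>w_star_exp\<close>.\<close>
      have "\<not> eventually (\<lambda>X. has_small_int_poly n \<xi> (C * X powr \<theta> w) (C * X powr (- (\<theta> w * w)))) at_top"
        using w_hat_exp_ge[OF nroot C, of "\<theta> w" u "\<theta> w * w"] u \<theta>(1)[OF w(2)] by auto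
      then show "frequently (\<lambda>X. \<not> has_small_int_poly n \<xi> (C * X powr \<theta> w)
          (C * X powr (- (1 + (real n - 1) * \<theta> w)))) at_top"
        unfolding \<theta>(2)[OF w(2)] by (simp add: not_eventually)
    qed (use \<theta>[OF w(2)] in auto)
  qed
  ultimately show ?thesis by blast
qed

end
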